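(* Let $Z=\{z_1,z_2,\ldots\}$ and let $I:\mathbb{Q}\langle Z\rangle\to\mathcal{Z}$ be the linear map sending a word to its corresponding iterated integral, normalised so that $I(u\,\hat{\sqcup\!\sqcup}\,v)=0$ for all non-empty words $u,v$ in $Z$, where $\hat{\sqcup\!\sqcup}$ is the block shuffle product. Let $\lozenge$ be the bilinear product on the span $\mathbb{Q}Z$ of the letters with $z_m\lozenge z_n=z_{m+n}$. Then for every $z\in\mathbb{Q}Z$ and every integer $k\ge 1$, $$I(z^{2k+1})=\frac{1}{2k+1}I\left(z^{\lozenge (2k+1)}\right)\in I(\mathbb{Q}Z)\subset\mathbb{Q}[\pi^2]$$ and $$I(z^{2k})=0.$$ Here $z^n$ denotes the concatenation power in $\mathbb{Q}\langle Z\rangle$ and $z^{\lozenge n}$ the $n$-th power with respect to $\lozenge$.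
   Context: $\mathcal{Z}$ is the $\mathbb{Q}$-algebra of multiple zeta values, i.e. the $\mathbb{Q}$-span of $1$ and all $\zeta(n_1,\ldots,n_r)=\sum_{1\le k_1<\cdots<k_r}k_1^{-n_1}\cdots k_r^{-n_r}$, with positive integers $n_i$ and $n_r\ge 2$. Block encoding: a word in $\{e_0,e_1\}$ is alternating if it is non-empty and contains no factor $e_0e_0$ or $e_1e_1$. Every non-empty word $w$ has a unique minimal factorisation $w=w_1\cdots w_k$ into alternating words; it is the one in which the last letter of $w_i$ equals the first letter of $w_{i+1}$ for $1\le i<k$. Mapping a word $w$ beginning with $e_0$ to $z_{|w_1|}\cdots z_{|w_k|}$ ($|\cdot|$ denoting length) identifies the words beginning with $e_0$ with the non-empty words in $Z$. The map $I$: if the word $e_{a_0}e_{a_1}\cdots e_{a_{n+1}}$ (with $a_0=0$) corresponds to a word in $Z$, and if $a_{n+1}=1$ and either $n=0$ or ($a_1=1$ and $a_n=0$), then $I$ of that word is $$I(0;a_1,\ldots,a_n;1)=\int_{0\le t_1\le\cdots\le t_n\le 1}\prod_{k=1}^n\frac{dt_k}{t_k-a_k},$$ which is $1$ for $n=0$. One has $\zeta(n_1,\ldots,n_r)=(-1)^r I(0;1,\{0\}^{n_1-1},1,\{0\}^{n_2-1},\ldots,1,\{0\}^{n_r-1};1)$. If $a_{n+1}=0$, equivalently if $i_1+\cdots+i_k\equiv k \pmod 2$ for the word $z_{i_1}\cdots z_{i_k}$, then $I(z_{i_1}\cdots z_{i_k})=0$; also $I(1)=0$ for the empty word. On the remaining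 (divergent) words, $I$ takes values in $\mathcal{Z}$ given by some fixed choice of normalisation (regularisation), for which $I$ vanishes on all block shuffle products of non-empty words (the paper relies on a theorem of Hirose and Sato for this). Block shuffle product: the bilinear product on $\mathbb{Q}\langle Z\rangle$ defined recursively by $w\,\hat{\sqcup\!\sqcup}\,1=1\,\hat{\sqcup\!\sqcup}\,w=w$ and $z_au\,\hat{\sqcup\!\sqcup}\,z_bv=z_a(u\,\hat{\sqcup\!\sqcup}\,z_bv)+z_b(z_au\,\hat{\sqcup\!\sqcup}\,v)-\zeta_{a+b}(u\,\hat{\sqcup\!\sqcup}\,v)$ for words $u,v,w$, where $\zeta_c$ is the linear map with $\zeta_c(1)=0$ and $\zeta_c(z_bw)=z_{b+c}w$. It is commutative and associative. *)

theory Defs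
  imports "HOL-Analysis.Analysis" "HOL-Library.Poly_Mapping"
    "HOL-Computational_Algebra.Polynomial"
begin

text \<open>The letter \<open>z\<^sub>n\<close> (\<open>n \<ge> 1\<close>) is represented by its index \<open>n\<close>; accordingly \<open>a + b\<close>
  is the index of \<open>z\<^bsub>a+b\<^esub>\<close>.\<close>

typedef posnat = "{n :: nat. 1 \<le> n}" morphisms index posnat_of
  by auto

instantiation posnat :: ab_semigroup_add
begin

definition plus_posnat :: "posnat \<Rightarrow> posnat \<Rightarrow> posnat" where
  "a + b = posnat_of (index a + index b)"

lemma index_plus: "index (a + b) = index a + index b"
  using index[of a] by (simp add: plus_posnat_def posnat_of_inverse)

instance
  by standard (simp_all add: index_plus flip: index_inject)

end

text \<open>Words form a monoid under concatenation, so that the multiplication of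
  \<open>'a list \<Rightarrow>\<^sub>0 rat\<close> is the concatenation product, with the empty word as unit.\<close>

instantiation list :: (type) monoid_add
begin

definition zero_list :: "'a list" where "0 = []"
definition plus_list :: "'a list \<Rightarrow> 'a list \<Rightarrow> 'a list" where "u + v = u @ v"

instance
  by standard (simp_all add: zero_list_def plus_list_def)

end

type_synonym free_algebra_Z = "posnat list \<Rightarrow>\<^sub>0 rat"

definition word :: "posnat list \<Rightarrow> free_algebra_Z" where
  "word w = Poly_Mapping.single w 1"

definition scale :: "rat \<Rightarrow> ('a \<Rightarrow>\<^sub>0 rat) \<Rightarrow> ('a \<Rightarrow>\<^sub>0 rat)" where
  "scale c p = Poly_Mapping.map ((*) c) p"

definition real_scale :: "rat \<Rightarrow> real \<Rightarrow> real" where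
  "real_scale c x = of_rat c * x"

lemma lookup_scale: "Poly_Mapping.lookup (scale c p) k = c * Poly_Mapping.lookup p k"
  by (simp add: scale_def Poly_Mapping.map.rep_eq when_def)

lemma vector_space_scale: "vector_space scale"
  by unfold_locales
    (auto intro!: poly_mapping_eqI simp: lookup_scale lookup_add algebra_simps)

lemma vector_space_real_scale: "vector_space real_scale"
  by unfold_locales (auto simp: real_scale_def algebra_simps of_rat_add of_rat_mult)

definition linear_extension :: "('a \<Rightarrow> 'b \<Rightarrow>\<^sub>0 rat) \<Rightarrow> ('a \<Rightarrow>\<^sub>0 rat) \<Rightarrow> ('b \<Rightarrow>\<^sub>0 rat)" where
  "linear_extension f p =
     (\<Sum>u\<in>Poly_Mapping.keys p. scale (Poly_Mapping.lookup p u) (f u))"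

definition bilinear_extension ::
    "('a \<Rightarrow> 'b \<Rightarrow> 'c \<Rightarrow>\<^sub>0 rat) \<Rightarrow> ('a \<Rightarrow>\<^sub>0 rat) \<Rightarrow> ('b \<Rightarrow>\<^sub>0 rat) \<Rightarrow> ('c \<Rightarrow>\<^sub>0 rat)" where
  "bilinear_extension f p q = linear_extension (\<lambda>u. linear_extension (f u) q) p"

text \<open>This is \<open>\<zeta>\<^sub>c\<close>; note \<open>\<zeta>\<^sub>c(1) = 0\<close> on the empty word.\<close>

definition letter_shift :: "posnat \<Rightarrow> free_algebra_Z \<Rightarrow> free_algebra_Z" where
  "letter_shift c =
     linear_extension (\<lambda>w. case w of [] \<Rightarrow> 0 | b # v \<Rightarrow> word ((b + c) # v))"

fun block_shuffle_words :: "posnat list \<Rightarrow> posnat list \<Rightarrow> free_algebra_Z" where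
  "block_shuffle_words [] w = word w"
| "block_shuffle_words w [] = word w"
| "block_shuffle_words (a # u) (b # v) =
     word [a] * block_shuffle_words u (b # v) + word [b] * block_shuffle_words (a # u) v
       - letter_shift (a + b) (block_shuffle_words u v)"

definition block_shuffle :: "free_algebra_Z \<Rightarrow> free_algebra_Z \<Rightarrow> free_algebra_Z" where
  "block_shuffle = bilinear_extension block_shuffle_words"

definition letter_span :: "free_algebra_Z set" where
  "letter_span = module.span scale (range (\<lambda>a. word [a]))"

text \<open>Only the restriction to the span of the letters is meaningful; words of length other
  than \<open>1\<close> are sent to \<open>0\<close>.\<close>

definition lozenge :: "free_algebra_Z \<Rightarrow> free_algebra_Z \<Rightarrow> free_algebra_Z" where
  "lozenge = bilinear_extension
     (\<lambda>u v. case (u, v) of ([a], [b]) \<Rightarrow> word [a + b] | _ \<Rightarrow> 0)"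

text \<open>The product has no unit, so the power is meaningful only for \<open>n \<ge> 1\<close>.\<close>

definition lozenge_power :: "free_algebra_Z \<Rightarrow> nat \<Rightarrow> free_algebra_Z" where
  "lozenge_power z n = (lozenge z ^^ (n - 1)) z"

text \<open>A word \<open>e\<^bsub>a\<^sub>0\<^esub>e\<^bsub>a\<^sub>1\<^esub>\<dots>\<close> in \<open>e\<^sub>0, e\<^sub>1\<close> is represented by the list
  \<open>[a\<^sub>0, a\<^sub>1, \<dots>]\<close> of its subscripts.\<close>

definition e_word :: "nat list \<Rightarrow> bool" where
  "e_word w \<longleftrightarrow> set w \<subseteq> {0, 1}"

definition alternating :: "nat list \<Rightarrow> bool" where
  "alternating w \<longleftrightarrow> w \<noteq> [] \<and> distinct_adj w"

definition alternating_factorisation :: "nat list \<Rightarrow> nat list list \<Rightarrow> bool" where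
  "alternating_factorisation w ws \<longleftrightarrow> concat ws = w \<and> (\<forall>v\<in>set ws. alternating v)"

definition minimal_factorisation :: "nat list \<Rightarrow> nat list list \<Rightarrow> bool" where
  "minimal_factorisation w ws \<longleftrightarrow> alternating_factorisation w ws \<and>
     (\<forall>vs. alternating_factorisation w vs \<longrightarrow> length ws \<le> length vs)"

text \<open>\<open>corresponds w u\<close>: the word \<open>w\<close> in \<open>e\<^sub>0, e\<^sub>1\<close> starts with \<open>e\<^sub>0\<close> and is identified with
  the word \<open>u\<close> in \<open>Z\<close>.\<close>

definition corresponds :: "nat list \<Rightarrow> posnat list \<Rightarrow> bool" where
  "corresponds w u \<longleftrightarrow> e_word w \<and> w \<noteq> [] \<and> hd w = 0 \<and>
     (\<exists>ws. minimal_factorisation w ws \<and> map length ws = map index u)"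

definition mzv :: "nat list \<Rightarrow> real" where
  "mzv ns = (\<Sum>\<^sub>\<infinity>ks\<in>{ks :: nat list. length ks = length ns \<and> sorted_wrt (<) ks \<and> (\<forall>k\<in>set ks. 1 \<le> k)}.
     \<Prod>i<length ns. 1 / real (ks ! i) ^ (ns ! i))"

definition MZV :: "real set" where
  "MZV = module.span real_scale
     (insert 1 {mzv ns | ns. ns \<noteq> [] \<and> (\<forall>n\<in>set ns. 1 \<le> n) \<and> 2 \<le> last ns})"

text \<open>\<open>I(0; a\<^sub>1, \<dots>, a\<^sub>n; 1)\<close>; list positions, and hence the variables of integration, are
  numbered from \<open>0\<close>. For \<open>n = 0\<close> the measure is a unit point mass, so the value is \<open>1\<close>.\<close>

definition simplex_domain :: "nat \<Rightarrow> (nat \<Rightarrow> real) set" where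
  "simplex_domain n = {t \<in> space (Pi\<^sub>M {..<n} (\<lambda>_. lborel)).
     (\<forall>i<n. 0 \<le> t i \<and> t i \<le> 1) \<and> (\<forall>i j. i < j \<and> j < n \<longrightarrow> t i \<le> t j)}"

definition iterated_integral :: "nat list \<Rightarrow> real" where
  "iterated_integral as =
     set_lebesgue_integral (Pi\<^sub>M {..<length as} (\<lambda>_. lborel)) (simplex_domain (length as))
       (\<lambda>t. \<Prod>k<length as. 1 / (t k - real (as ! k)))"

text \<open>The possible maps \<open>I\<close>. On divergent words only the membership in \<open>MZV\<close> and the
  vanishing on block shuffle products are imposed, so that any choice of
  normalisation with these properties is covered.\<close>

definition block_integral_map :: "(free_algebra_Z \<Rightarrow> real) \<Rightarrow> bool" where
  "block_integral_map I \<longleftrightarrow>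
     Vector_Spaces.linear scale real_scale I \<and>
     range I \<subseteq> MZV \<and>
     I (word []) = 0 \<and>
     (\<forall>as u. corresponds (0 # as @ [1]) u \<and> (as = [] \<or> hd as = 1 \<and> last as = 0) \<longrightarrow>
        I (word u) = iterated_integral as) \<and>
     (\<forall>w u. corresponds w u \<and> last w = 0 \<longrightarrow> I (word u) = 0) \<and>
     (\<forall>u v. u \<noteq> [] \<and> v \<noteq> [] \<longrightarrow> I (block_shuffle (word u) (word v)) = 0)"

definition Q_pi_squared :: "real set" where
  "Q_pi_squared = range (\<lambda>p :: rat poly. poly (map_poly of_rat p) (pi\<^sup>2))"

end

theory Submission
  imports Defs
begin

text \<open>
  The two assertions on powers come from block shuffles whose first factor is a combination of
  letters. For \<open>y\<close> in the letter span let \<open>A(y, n)\<close> be the sum of the \<open>n + 1\<close> products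
  obtained by inserting \<open>y\<close> into \<open>z\<^sup>n\<close> (\<open>insertions\<close>). Unrolling the recursion of the block shuffle product gives
  \<open>y \<squnion> z\<^sup>n = A(y, n) - A(z \<lozenge> z \<lozenge> y, n - 2)\<close>, where the second term is
  absent for \<open>n < 2\<close> (\<open>block_shuffle_power\<close>). So \<open>I\<close> does not change when two factors
  \<open>z\<close> are absorbed into \<open>y\<close>, and repeating this leads from \<open>A(z, 2k) = (2k + 1) z\<^bsup>2k+1\<^esup>\<close>
  down to the single letter \<open>z\<^bsup>\<lozenge>(2k+1)\<^esup>\<close>, and from
  \<open>A(z, 2k - 1) = 2k z\<^bsup>2k\<^esup>\<close> down to some \<open>A(y, 1) = y \<squnion> z\<close>, on which \<open>I\<close> is
  zero (\<open>block_integral_power\<close>).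

  It remains to see that \<open>I(z\<^sub>n)\<close> is a rational polynomial in \<open>\<pi>\<^sup>2\<close>. The letter \<open>z\<^sub>n\<close>
  encodes the alternating word of length \<open>n\<close>, so \<open>I\<close> vanishes for odd \<open>n\<close>, while
  \<open>I(z\<^bsub>2m+2\<^esub>)\<close> is the iterated integral of \<open>1, 0, \<dots>, 1, 0\<close>. Integrating one
  variable at a time and expanding each partial integral as a power series in its upper limit yields
  \<open>(-1)\<^sup>m \<zeta>(2, \<dots>, 2)\<close> with \<open>m\<close> entries (\<open>iterated_integral_zeta22\<close>). These zeta values
  are the limits of the elementary symmetric functions of \<open>1/1\<^sup>2, \<dots>, 1/N\<^sup>2\<close>, hence have
  generating function \<open>\<Prod> (1 + s/k\<^sup>2)\<close>, and Euler's product for the sine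
  evaluates them to \<open>\<pi>\<^bsup>2m\<^esup> / (2m + 1)!\<close> (\<open>zeta22_eq\<close>).
\<close>

section \<open>Linear and bilinear extension in the free algebra\<close>

interpretation free_vs: vector_space scale
  by (rule vector_space_scale)

lemmas scale_simps = free_vs.scale_right_distrib free_vs.scale_right_diff_distrib

text \<open>Scalars are the multiples of the empty word, which is the unit and commutes with everything;
  associativity then moves them through products.\<close>

lemma scale_eq_single_mult: "scale c p = Poly_Mapping.single 0 c * p"
  and scale_eq_mult_single: "scale c p = p * Poly_Mapping.single 0 c"
  for p :: "'a::monoid_add \<Rightarrow>\<^sub>0 rat"
proof -
  have "Sum_any (\<lambda>b. c when b = 0 when k = a + b) = (c when k = a)" for k a :: 'a
  proof -
    have "Sum_any (\<lambda>b. c when b = 0 when k = a + b) = Sum_any (\<lambda>b :: 'a. (c when k = a) when b = 0)"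
      by (rule Sum_any.cong) (auto simp: when_def)
    then show ?thesis by simp
  qed
  then show "scale c p = p * Poly_Mapping.single 0 c"
    by (auto intro!: poly_mapping_eqI simp: lookup_scale lookup_mult lookup_single when_mult mult_when
          eq_commute[of 0])
  show "scale c p = Poly_Mapping.single 0 c * p"
    by (auto intro!: poly_mapping_eqI simp: lookup_scale lookup_mult lookup_single when_mult
          eq_commute[of 0])
qed

lemma scale_mult_left [simp]: "scale c p * q = scale c (p * q)"
  and scale_mult_right [simp]: "p * scale c q = scale c (p * q)"
  for p q :: "'a::monoid_add \<Rightarrow>\<^sub>0 rat"
  by (simp add: scale_eq_single_mult mult.assoc) (simp add: scale_eq_mult_single mult.assoc)

lemma linear_extension_superset:
  assumes "finite A" "Poly_Mapping.keys p \<subseteq> A"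
  shows "linear_extension f p = (\<Sum>u\<in>A. scale (Poly_Mapping.lookup p u) (f u))"
  unfolding linear_extension_def
  using assms by (intro sum.mono_neutral_left) (auto simp: in_keys_iff)

lemma linear_extension_zero [simp]: "linear_extension f 0 = 0"
  by (simp add: linear_extension_def)

lemma linear_extension_add [simp]:
  "linear_extension f (p + q) = linear_extension f p + linear_extension f q"
proof -
  let ?A = "Poly_Mapping.keys p \<union> Poly_Mapping.keys q"
  show ?thesis
    using keys_add[of p q]
    by (simp add: linear_extension_superset[of ?A] lookup_add free_vs.scale_left_distrib sum.distrib)
qed

lemma linear_extension_scale [simp]:
  "linear_extension f (scale c p) = scale c (linear_extension f p)"
proof -
  have "Poly_Mapping.keys (scale c p) \<subseteq> Poly_Mapping.keys p"
    by (auto simp: in_keys_iff lookup_scale)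
  then show ?thesis
    by (simp add: linear_extension_superset[of "Poly_Mapping.keys p"] lookup_scale
        free_vs.scale_sum_right)
qed

lemma linear_extension_word [simp]: "linear_extension f (word w) = f w"
  by (simp add: linear_extension_def word_def)

lemma linear_extension_fun:
  "linear_extension (\<lambda>u. f u + g u) p = linear_extension f p + linear_extension g p"
  "linear_extension (\<lambda>u. scale c (f u)) p = scale c (linear_extension f p)"
  "linear_extension (\<lambda>u. 0) p = 0"
  by (simp_all add: linear_extension_def free_vs.scale_right_distrib sum.distrib
      free_vs.scale_sum_right mult.commute)

lemma bilinear_extension_simps [simp]:
  "bilinear_extension f 0 q = 0"
  "bilinear_extension f p 0 = 0"
  "bilinear_extension f (p + p') q = bilinear_extension f p q + bilinear_extension f p' q"
  "bilinear_extension f p (q + q') = bilinear_extension f p q + bilinear_extension f p q'"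
  "bilinear_extension f (scale c p) q = scale c (bilinear_extension f p q)"
  "bilinear_extension f p (scale c q) = scale c (bilinear_extension f p q)"
  "bilinear_extension f (word u) (word v) = f u v"
  by (simp_all add: bilinear_extension_def linear_extension_fun)

lemma word_append: "word u * word v = word (u @ v)"
  by (simp add: word_def mult_single plus_list_def)

lemma word_Nil: "word [] = 1"
  by (simp add: word_def zero_list_def[symmetric])

text \<open>Identities that are linear in an element of the letter span, or of the whole algebra, need
  only be checked on letters, respectively on words, by the following two rules.\<close>

lemma letter_span_induct [consumes 1, case_names zero step]:
  assumes "p \<in> letter_span" "P 0"
    and "\<And>c a q. P q \<Longrightarrow> P (scale c (word [a]) + q)"
  shows "P p"
  using assms(1) unfolding letter_span_def
  by (induction p rule: free_vs.span_induct_alt) (use assms in auto)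

lemma free_algebra_induct [case_names zero step]:
  fixes p :: free_algebra_Z
  assumes "P 0" and "\<And>c w q. P q \<Longrightarrow> P (scale c (word w) + q)"
  shows "P p"
proof -
  have P_sum: "P (\<Sum>w\<in>A. scale (Poly_Mapping.lookup p w) (word w))" if "finite A" for A
    using that by (induction A) (auto intro: assms)
  have "(\<Sum>w\<in>Poly_Mapping.keys p. scale (Poly_Mapping.lookup p w) (word w)) = p"
    by (rule poly_mapping_eqI)
      (auto simp: lookup_sum lookup_scale word_def lookup_single when_def sum.delta in_keys_iff
        if_distrib[of "(*) _"] cong: if_cong)
  then show ?thesis
    using P_sum[of "Poly_Mapping.keys p"] by simp
qed

lemma letter_in_letter_span: "word [a] \<in> letter_span"
  by (simp add: letter_span_def free_vs.span_base)

lemma letter_span_closed: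
  "0 \<in> letter_span"
  "p \<in> letter_span \<Longrightarrow> q \<in> letter_span \<Longrightarrow> p + q \<in> letter_span"
  "p \<in> letter_span \<Longrightarrow> scale c p \<in> letter_span"
  by (auto simp: letter_span_def intro: free_vs.span_add free_vs.span_scale free_vs.span_zero)

lemma lozenge_in_letter_span:
  assumes "p \<in> letter_span" "q \<in> letter_span"
  shows "lozenge p q \<in> letter_span"
  using assms(1)
proof (induction p rule: letter_span_induct)
  case zero
  then show ?case by (simp add: lozenge_def letter_span_closed)
next
  case (step c a p)
  have "lozenge (word [a]) q \<in> letter_span"
    using assms(2)
    by (induction q rule: letter_span_induct)
      (auto simp: lozenge_def intro!: letter_span_closed letter_in_letter_span)
  with step show ?case
    by (auto simp: lozenge_def intro!: letter_span_closed)
qed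

section \<open>Block shuffling a letter into a word\<close>

text \<open>The extension of \<open>\<zeta>\<^sub>c\<close> from single letters \<open>z\<^sub>c\<close> to all of the letter span, so that
  the block shuffle recursion can be written without coordinates.\<close>

definition prefix_shift :: "free_algebra_Z \<Rightarrow> free_algebra_Z \<Rightarrow> free_algebra_Z" where
  "prefix_shift =
     bilinear_extension (\<lambda>u v. case u of [c] \<Rightarrow> letter_shift c (word v) | _ \<Rightarrow> 0)"

lemmas block_shuffle_bilinear [simp] =
  bilinear_extension_simps[of block_shuffle_words, folded block_shuffle_def]

lemmas lozenge_bilinear [simp] =
  bilinear_extension_simps[of "\<lambda>u v. case (u, v) of ([a], [b]) \<Rightarrow> word [a + b] | _ \<Rightarrow> 0",
    folded lozenge_def]

lemmas prefix_shift_bilinear [simp] =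
  bilinear_extension_simps[of "\<lambda>u v. case u of [c] \<Rightarrow> letter_shift c (word v) | _ \<Rightarrow> 0",
    folded prefix_shift_def]

lemma prefix_shift_one: "p \<in> letter_span \<Longrightarrow> prefix_shift p 1 = 0"
  by (induction p rule: letter_span_induct)
    (auto simp: letter_shift_def simp flip: word_Nil)

lemma prefix_shift_letter_mult:
  assumes "x \<in> letter_span" "z \<in> letter_span"
  shows "prefix_shift x (z * v) = lozenge z x * v"
proof -
  have A: "prefix_shift (word [a]) (word [b] * v) = lozenge (word [b]) (word [a]) * v" for a b v
    by (induction v rule: free_algebra_induct)
      (simp_all add: letter_shift_def word_append distrib_left)
  have B: "prefix_shift (word [a]) (z * v) = lozenge z (word [a]) * v" for a
    using assms(2)
    by (induction z rule: letter_span_induct)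
      (simp_all add: A distrib_right del: prefix_shift_bilinear(7) lozenge_bilinear(7))
  show ?thesis
    using assms(1)
    by (induction x rule: letter_span_induct) (simp_all add: B distrib_right)
qed

lemma block_shuffle_words_letter:
  "block_shuffle_words [a] (b # v) = word [a] * word (b # v) +
     word [b] * block_shuffle_words [a] v - letter_shift (a + b) (word v)"
  by (cases v) simp_all

text \<open>The defining recursion with first factor a single letter. Since the first factor is then
  exhausted, the correction term applies \<open>\<zeta>\<close> to \<open>v\<close> itself, and both sides are trilinear in
  \<open>y\<close>, \<open>z\<close> and \<open>v\<close>. The bilinear extension rules for words are switched off where they
  would rewrite an instance on words back to its coordinates.\<close>

lemma block_shuffle_letter:
  assumes "y \<in> letter_span" "z \<in> letter_span"
  shows "block_shuffle y (z * v) =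
    y * z * v + z * block_shuffle y v - prefix_shift (lozenge z y) v"
proof -
  have A: "block_shuffle (word [a]) (word [b] * v) = word [a] * word [b] * v +
    word [b] * block_shuffle (word [a]) v - prefix_shift (lozenge (word [b]) (word [a])) v" for a b v
  proof (induction v rule: free_algebra_induct)
    case (step c w q)
    have "block_shuffle (word [a]) (word [b] * word w) = word [a] * word [b] * word w +
       word [b] * block_shuffle (word [a]) (word w) - prefix_shift (lozenge (word [b]) (word [a])) (word w)"
      by (simp add: block_shuffle_words_letter word_append add.commute
          del: block_shuffle_words.simps)
    then show ?case
      by (simp add: step distrib_left scale_simps
          del: block_shuffle_bilinear(7) lozenge_bilinear(7) prefix_shift_bilinear(7))
  qed simp
  have B: "block_shuffle (word [a]) (z * v) = word [a] * z * v +
    z * block_shuffle (word [a]) v - prefix_shift (lozenge z (word [a])) v" for a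
    using assms(2)
    by (induction z rule: letter_span_induct)
      (simp_all add: A distrib_left distrib_right scale_simps
          del: block_shuffle_bilinear(7) lozenge_bilinear(7) prefix_shift_bilinear(7))
  show ?thesis
    using assms(1)
    by (induction y rule: letter_span_induct)
      (simp_all add: B distrib_left distrib_right scale_simps)
qed

lemma block_shuffle_one: "y \<in> letter_span \<Longrightarrow> block_shuffle y 1 = y"
  by (induction y rule: letter_span_induct)
    (auto simp flip: word_Nil)

section \<open>Powers of an element of the letter span\<close>

definition insertions :: "free_algebra_Z \<Rightarrow> free_algebra_Z \<Rightarrow> nat \<Rightarrow> free_algebra_Z" where
  "insertions y z n = (\<Sum>i\<le>n. z ^ i * y * z ^ (n - i))"

lemma insertions_0: "insertions y z 0 = y"
  by (simp add: insertions_def)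

lemma insertions_Suc: "insertions y z (Suc n) = y * z ^ Suc n + z * insertions y z n"
  unfolding insertions_def
  by (subst sum.atMost_Suc_shift) (simp add: sum_distrib_left mult.assoc)

lemma insertions_self: "insertions z z n = of_nat (Suc n) * z ^ Suc n"
proof -
  have "insertions z z n = (\<Sum>i\<le>n. z ^ Suc n)"
    unfolding insertions_def
  proof (rule sum.cong)
    fix i assume "i \<in> {..n}"
    then have "z ^ Suc n = z ^ (Suc i + (n - i))"
      by simp
    then show "z ^ i * z * z ^ (n - i) = z ^ Suc n"
      by (simp only: power_add power_Suc2)
  qed simp
  then show ?thesis by simp
qed

text \<open>Shuffling \<open>y\<close> into \<open>z\<^sup>n\<close> inserts \<open>y\<close> at every position, and for every pair of
  neighbouring factors subtracts the term in which the pair and \<open>y\<close> between them are merged into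
  one letter. The merged letter is again a letter inserted into a power of \<open>z\<close>, with two factors
  fewer. At the right end nothing is merged, because \<open>\<zeta>\<^sub>c(1) = 0\<close>.\<close>

lemma block_shuffle_power:
  assumes "y \<in> letter_span" "z \<in> letter_span"
  shows "block_shuffle y (z ^ n) = insertions y z n -
    (if n \<ge> 2 then insertions (lozenge z (lozenge z y)) z (n - 2) else 0)"
proof (induction n)
  case 0
  then show ?case
    using assms by (simp add: block_shuffle_one insertions_0)
next
  case (Suc n)
  have zy: "lozenge z y \<in> letter_span"
    using assms by (intro lozenge_in_letter_span)
  consider "n = 0" | "n = 1" | m where "n = Suc (Suc m)"
    by (metis One_nat_def not0_implies_Suc)
  then show ?case
  proof cases
    case 1
    then show ?thesis
      using Suc assms zy block_shuffle_letter[of y z 1]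
      by (simp add: prefix_shift_one insertions_Suc)
  next
    case 2
    then show ?thesis
      using Suc assms zy block_shuffle_letter[of y z z] prefix_shift_letter_mult[OF zy assms(2), of 1]
      by (simp add: insertions_Suc insertions_0 mult.assoc)
  next
    case 3
    then show ?thesis
      using Suc assms zy block_shuffle_letter[of y z "z ^ n"]
        prefix_shift_letter_mult[OF zy assms(2), of "z ^ Suc m"]
      by (simp add: insertions_Suc mult.assoc right_diff_distrib)
  qed
qed

lemma block_integral_mapD:
  assumes "block_integral_map I"
  shows "I (p + q) = I p + I q" "I (p - q) = I p - I q" "I 0 = 0"
    "I (scale c p) = of_rat c * I p"
proof -
  have "module_hom scale real_scale I"
    using assms by (simp add: block_integral_map_def linear_iff_module_hom)
  from module_hom.add[OF this] module_hom.diff[OF this] module_hom.zero[OF this] module_hom.scale[OF this]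
  show "I (p + q) = I p + I q" "I (p - q) = I p - I q" "I 0 = 0" "I (scale c p) = of_rat c * I p"
    by (simp_all add: real_scale_def)
qed

lemma block_integral_map_letter_shuffle:
  assumes I: "block_integral_map I" and "y \<in> letter_span" "z \<in> letter_span"
  shows "I (block_shuffle y (z * v)) = 0"
proof -
  note lin = block_integral_mapD[OF I]
  have A: "I (block_shuffle (word [a]) (word [b] * v)) = 0" for a b v
  proof (induction v rule: free_algebra_induct)
    case (step c w q)
    have "I (block_shuffle (word [a]) (word [b] * word w)) = 0"
      using I by (simp add: block_integral_map_def word_append del: block_shuffle_words.simps)
    then show ?case
      by (simp add: step distrib_left lin del: block_shuffle_bilinear(7))
  qed (simp add: lin)
  have B: "I (block_shuffle (word [a]) (z * v)) = 0" for a
    using assms(3)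
    by (induction z rule: letter_span_induct) (simp_all add: A distrib_right lin)
  show ?thesis
    using assms(2)
    by (induction y rule: letter_span_induct) (simp_all add: B lin)
qed

lemma block_integral_insertions_1:
  assumes "block_integral_map I" "y \<in> letter_span" "z \<in> letter_span"
  shows "I (insertions y z 1) = 0"
  using block_integral_map_letter_shuffle[OF assms, of 1] block_shuffle_power[OF assms(2,3), of 1]
  by simp

lemma block_integral_insertions_step:
  assumes "block_integral_map I" "y \<in> letter_span" "z \<in> letter_span"
  shows "I (insertions y z (Suc (Suc n))) = I (insertions (lozenge z (lozenge z y)) z n)"
  using block_integral_map_letter_shuffle[OF assms, of "z ^ Suc n"]
    block_shuffle_power[OF assms(2,3), of "Suc (Suc n)"]
  by (simp add: block_integral_mapD[OF assms(1)])

text \<open>Since \<open>I\<close> kills the block shuffles, two factors \<open>z\<close> at a time are absorbed into the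
  inserted letter. An even power ends with a single letter; an odd one ends with
  \<open>y z + z y\<close>, which is itself a block shuffle.\<close>

lemma block_integral_insertions:
  assumes "block_integral_map I" "y \<in> letter_span" "z \<in> letter_span"
  shows "I (insertions y z (2 * m)) = I ((lozenge z ^^ (2 * m)) y)"
    and "I (insertions y z (2 * m + 1)) = 0"
proof -
  have "I (insertions y z (2 * m)) = I ((lozenge z ^^ (2 * m)) y) \<and> I (insertions y z (2 * m + 1)) = 0"
    using assms(2)
  proof (induction m arbitrary: y)
    case 0
    then show ?case
      using block_integral_insertions_1[OF assms(1) 0 assms(3)] by (simp add: insertions_0)
  next
    case (Suc m)
    have "lozenge z (lozenge z y) \<in> letter_span"
      using Suc.prems assms(3) by (intro lozenge_in_letter_span)
    from Suc.IH[OF this] show ?case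
      using block_integral_insertions_step[OF assms(1) Suc.prems assms(3)]
      by (simp add: funpow_swap1)
  qed
  then show "I (insertions y z (2 * m)) = I ((lozenge z ^^ (2 * m)) y)"
    and "I (insertions y z (2 * m + 1)) = 0" by auto
qed

lemma of_nat_mult_eq_scale: "of_nat n * p = scale (of_nat n) p" for p :: free_algebra_Z
  by (induction n) (simp_all add: free_vs.scale_left_distrib distrib_right)

text \<open>Inserting \<open>z\<close> itself into \<open>z\<^sup>n\<close> gives \<open>n + 1\<close> copies of \<open>z\<^bsup>n+1\<^esup>\<close>; this is where the
  factor \<open>2m + 1\<close> comes from.\<close>

lemma block_integral_power:
  assumes "block_integral_map I" "z \<in> letter_span"
  shows "real (2 * m + 1) * I (z ^ (2 * m + 1)) = I (lozenge_power z (2 * m + 1))"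
    and "I (z ^ (2 * m + 2)) = 0"
proof -
  have ins: "I (insertions z z n) = real (Suc n) * I (z ^ Suc n)" for n
    by (simp only: insertions_self of_nat_mult_eq_scale block_integral_mapD[OF assms(1)]
        of_rat_of_nat_eq)
  show "real (2 * m + 1) * I (z ^ (2 * m + 1)) = I (lozenge_power z (2 * m + 1))"
    using ins[of "2 * m"] block_integral_insertions(1)[OF assms(1) assms(2,2), of m]
    by (simp add: lozenge_power_def)
  show "I (z ^ (2 * m + 2)) = 0"
    using ins[of "2 * m + 1"] block_integral_insertions(2)[OF assms(1) assms(2,2), of m]
    by (simp del: power_Suc)
qed

lemma lozenge_power_in_letter_span:
  assumes "z \<in> letter_span"
  shows "lozenge_power z n \<in> letter_span"
proof -
  have "(lozenge z ^^ k) z \<in> letter_span" for k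
    by (induction k) (auto intro: assms lozenge_in_letter_span)
  then show ?thesis by (simp add: lozenge_power_def)
qed

section \<open>The zeta values with all arguments 2\<close>

text \<open>\<open>zeta22_coeff m k\<close> is the part of the series \<open>\<zeta>(2, \<dots>, 2)\<close> (\<open>m\<close> entries) whose largest
  summation index is \<open>k\<close>; the index \<open>0\<close> serves the empty tuple.\<close>

fun zeta22_coeff :: "nat \<Rightarrow> nat \<Rightarrow> real" where
  "zeta22_coeff 0 k = (if k = 0 then 1 else 0)"
| "zeta22_coeff (Suc m) 0 = 0"
| "zeta22_coeff (Suc m) (Suc k) = (\<Sum>i\<le>k. zeta22_coeff m i) / real (Suc k) ^ 2"

definition zeta22 :: "nat \<Rightarrow> real" where
  "zeta22 m = suminf (\<lambda>k. zeta22_coeff m k)"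

lemma zeta22_coeff_nonneg [simp]: "zeta22_coeff m k \<ge> 0"
  by (induction m k rule: zeta22_coeff.induct) (auto intro!: sum_nonneg divide_nonneg_nonneg)

text \<open>Dropping the condition that the summation indices increase bounds the series by the
  \<open>m\<close>-th power of \<open>\<zeta>(2) = \<pi>\<^sup>2 / 6\<close>. Summability and the bound feed each other in the induction.\<close>

lemma zeta22_coeff_bound:
  "summable (zeta22_coeff m) \<and> zeta22 m \<le> (pi\<^sup>2 / 6) ^ m"
proof (induction m)
  case 0
  have "zeta22_coeff 0 sums 1"
    using sums_single[of 0 "\<lambda>_. 1 :: real"] by (simp add: zeta22_coeff.simps(1)[abs_def] cong: sums_cong)
  from sums_summable[OF this] sums_unique[OF this] show ?case
    by (simp add: zeta22_def del: zeta22_coeff.simps)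
next
  case (Suc m)
  have le: "zeta22_coeff (Suc m) (Suc k) \<le> (pi\<^sup>2 / 6) ^ m * (1 / real (Suc k) ^ 2)" for k
  proof -
    have "(\<Sum>i\<le>k. zeta22_coeff m i) \<le> zeta22 m"
      unfolding zeta22_def using Suc.IH by (intro sum_le_suminf) auto
    then have "(\<Sum>i\<le>k. zeta22_coeff m i) \<le> (pi\<^sup>2 / 6) ^ m"
      using Suc.IH by linarith
    then show ?thesis
      by (simp add: divide_right_mono)
  qed
  have sums: "(\<lambda>k. (pi\<^sup>2 / 6) ^ m * (1 / real (Suc k) ^ 2)) sums ((pi\<^sup>2 / 6) ^ m * (pi\<^sup>2 / 6))"
    using inverse_squares_sums by (intro sums_mult) (simp add: add.commute)
  have sm: "summable (\<lambda>k. zeta22_coeff (Suc m) (Suc k))"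
    using le by (intro summable_comparison_test'[OF sums_summable[OF sums], of 0])
      (simp del: zeta22_coeff.simps)
  then have "summable (zeta22_coeff (Suc m))"
    by (simp only: summable_Suc_iff)
  moreover have "zeta22 (Suc m) = suminf (\<lambda>k. zeta22_coeff (Suc m) (Suc k))"
    unfolding zeta22_def
    by (subst suminf_split_head[OF \<open>summable (zeta22_coeff (Suc m))\<close>]) simp
  moreover have "\<dots> \<le> (pi\<^sup>2 / 6) ^ Suc m"
    using suminf_le[OF le sm sums_summable[OF sums]] sums_unique[OF sums] by (simp add: mult.commute)
  ultimately show ?case by simp
qed

lemma zeta22_nonneg: "zeta22 m \<ge> 0"
  unfolding zeta22_def using zeta22_coeff_bound by (intro suminf_nonneg) auto

lemma zeta22_partial_sum_Suc:
  "(\<Sum>k\<le>Suc N. zeta22_coeff (Suc m) k) =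
     (\<Sum>k\<le>N. zeta22_coeff (Suc m) k) + (\<Sum>k\<le>N. zeta22_coeff m k) / real (Suc N) ^ 2"
  by simp

text \<open>The partial sums up to \<open>N\<close> are the elementary symmetric functions of \<open>1/1\<^sup>2, \<dots>, 1/N\<^sup>2\<close>,
  whose generating function is the product below.\<close>

lemma zeta22_partial_product:
  fixes s :: complex
  shows "(\<lambda>m. of_real (\<Sum>k\<le>N. zeta22_coeff m k) * s ^ m) sums (\<Prod>k=1..N. 1 + s / of_nat k ^ 2)"
proof (induction N)
  case 0
  have "(\<lambda>m. of_real (\<Sum>k\<le>0. zeta22_coeff m k) * s ^ m) = (\<lambda>m. if m = 0 then s ^ m else 0)"
  proof
    fix m show "of_real (\<Sum>k\<le>0. zeta22_coeff m k) * s ^ m = (if m = 0 then s ^ m else 0)"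
      by (cases m) auto
  qed
  then show ?case
    using sums_single[of 0 "\<lambda>m. s ^ m"] by simp
next
  case (Suc N)
  define S where "S = (\<lambda>N m. of_real (\<Sum>k\<le>N. zeta22_coeff m k) :: complex)"
  have zero: "S N 0 = 1" for N
    by (induction N) (auto simp: S_def)
  have rec: "S (Suc N) (Suc m) = S N (Suc m) + S N m / of_nat (Suc N) ^ 2" for m
    unfolding S_def zeta22_partial_sum_Suc by (simp add: add_divide_distrib)
  have IH: "(\<lambda>m. S N m * s ^ m) sums (\<Prod>k=1..N. 1 + s / of_nat k ^ 2)"
    using Suc.IH by (simp add: S_def)
  have "(\<lambda>m. S N (Suc m) * s ^ Suc m) sums ((\<Prod>k=1..N. 1 + s / of_nat k ^ 2) - 1)"
    using IH zero[of N] by (subst sums_Suc_iff) simp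
  have term_eq: "S N (Suc m) * s ^ Suc m + s / of_nat (Suc N) ^ 2 * (S N m * s ^ m) =
      S (Suc N) (Suc m) * s ^ Suc m" for m
    by (simp add: rec distrib_right)
  from sums_add[OF \<open>(\<lambda>m. S N (Suc m) * s ^ Suc m) sums _\<close> sums_mult[OF IH, of "s / of_nat (Suc N) ^ 2"]]
  have "(\<lambda>m. S (Suc N) (Suc m) * s ^ Suc m) sums ((\<Prod>k=1..N. 1 + s / of_nat k ^ 2) - 1
      + s / of_nat (Suc N) ^ 2 * (\<Prod>k=1..N. 1 + s / of_nat k ^ 2))"
    by (simp only: term_eq)
  also have "(\<Prod>k=1..N. 1 + s / of_nat k ^ 2) - 1
      + s / of_nat (Suc N) ^ 2 * (\<Prod>k=1..N. 1 + s / of_nat k ^ 2) =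
      (\<Prod>k=1..Suc N. 1 + s / of_nat k ^ 2) - 1"
    by (simp add: algebra_simps)
  finally have "(\<lambda>m. S (Suc N) (Suc m) * s ^ Suc m) sums ((\<Prod>k=1..Suc N. 1 + s / of_nat k ^ 2) - 1)" .
  then show ?case
    using zero[of "Suc N"] sums_Suc_iff[of "\<lambda>m. S (Suc N) m * s ^ m"]
    by (simp add: S_def)
qed

text \<open>The limit \<open>N \<longrightarrow> \<infinity>\<close> may be taken coefficientwise by dominated convergence
  (Tannery), because the \<open>m\<close>-th term is bounded by the geometric sequence of ratio
  \<open>(\<pi>\<^sup>2 / 6) \<bar>s\<bar> < 1\<close>.\<close>

lemma zeta22_generating_function:
  fixes s :: complex
  assumes "norm s < 6 / pi\<^sup>2"
  shows "(\<lambda>N. \<Prod>k=1..N. 1 + s / of_nat k ^ 2) \<longlonglongrightarrow> suminf (\<lambda>m. of_real (zeta22 m) * s ^ m)"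
    and "summable (\<lambda>m. of_real (zeta22 m) * s ^ m)"
proof -
  let ?M = "\<lambda>m. (pi\<^sup>2 / 6 * norm s) ^ m"
  have lim: "(\<lambda>N. of_real (\<Sum>k\<le>N. zeta22_coeff m k) * s ^ m) \<longlonglongrightarrow> of_real (zeta22 m) * s ^ m" for m
    unfolding zeta22_def using zeta22_coeff_bound[of m]
    by (intro tendsto_intros summable_LIMSEQ') auto
  have bound: "norm (of_real (\<Sum>k\<le>N. zeta22_coeff m k) * s ^ m) \<le> ?M m" for m N
  proof -
    have "(\<Sum>k\<le>N. zeta22_coeff m k) \<le> zeta22 m"
      unfolding zeta22_def using zeta22_coeff_bound by (intro sum_le_suminf) auto
    then have "(\<Sum>k\<le>N. zeta22_coeff m k) \<le> (pi\<^sup>2 / 6) ^ m"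
      using zeta22_coeff_bound[of m] by linarith
    then have "(\<Sum>k\<le>N. zeta22_coeff m k) * norm s ^ m \<le> (pi\<^sup>2 / 6) ^ m * norm s ^ m"
      by (rule mult_right_mono) simp
    then show ?thesis
      by (simp only: norm_mult norm_power norm_of_real abs_of_nonneg[OF sum_nonneg] zeta22_coeff_nonneg
          power_mult_distrib)
  qed
  have ev: "eventually (\<lambda>(m, N). norm (of_real (\<Sum>k\<le>N. zeta22_coeff m k) * s ^ m) \<le> ?M m)
      (at_top \<times>\<^sub>F at_top)"
    by (rule always_eventually) (use bound in \<open>simp only: split_paired_all prod.case, blast\<close>)
  have "norm (pi\<^sup>2 / 6 * norm s) < 1"
    using assms by (simp add: field_simps)
  then have "summable ?M"
    by (rule summable_geometric)
  note * = conjunct2[OF tannerys_theorem[OF lim ev this trivial_limit_sequentially]]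
  show "summable (\<lambda>m. of_real (zeta22 m) * s ^ m)"
    by (rule summable_norm_cancel[OF conjunct1[OF *]])
  show "(\<lambda>N. \<Prod>k=1..N. 1 + s / of_nat k ^ 2) \<longlonglongrightarrow> suminf (\<lambda>m. of_real (zeta22 m) * s ^ m)"
    using conjunct2[OF *] unfolding sums_unique[OF zeta22_partial_product, symmetric] .
qed

text \<open>With \<open>w\<^sup>2 = - s\<close> the sine series becomes a power series in \<open>s\<close>, up to the factor
  \<open>\<pi> w\<close>. The signs of the sine series are absorbed by \<open>- s\<close>.\<close>

lemma sin_series_in_square:
  fixes s w :: complex
  assumes "w\<^sup>2 = - s"
  shows "(\<lambda>m. of_real (pi ^ (2 * m) / fact (2 * m + 1)) * s ^ m * (of_real pi * w)) sums sin (of_real pi * w)"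
proof -
  have "(\<lambda>n. (\<lambda>n. sin_coeff n *\<^sub>R (of_real pi * w) ^ n) (2 * n + 1)) sums sin (of_real pi * w)"
    using sin_converges[of "of_real pi * w"]
    by (subst sums_mono_reindex) (auto simp: strict_mono_def sin_coeff_def elim!: evenE oddE)
  moreover have "sin_coeff (2 * m + 1) *\<^sub>R (of_real pi * w) ^ (2 * m + 1) =
    of_real (pi ^ (2 * m) / fact (2 * m + 1)) * s ^ m * (of_real pi * w)" for m
  proof -
    have "(of_real pi * w) ^ (2 * m + 1) = ((of_real pi * w)\<^sup>2) ^ m * (of_real pi * w)"
      by (simp only: power_add power_mult power_one_right)
    also have "(of_real pi * w)\<^sup>2 = (of_real pi)\<^sup>2 * (- s)"
      by (simp only: power_mult_distrib assms)
    also have "((of_real pi)\<^sup>2 * (- s)) ^ m = of_real pi ^ (2 * m) * ((-1) ^ m * s ^ m)"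
      by (simp only: power_mult_distrib power_mult power_minus[of s m])
    finally have pow: "(of_real pi * w) ^ (2 * m + 1) =
      of_real pi ^ (2 * m) * ((-1) ^ m * s ^ m) * (of_real pi * w)" .
    have coeff: "of_real (sin_coeff (2 * m + 1)) = (-1) ^ m * (of_real (1 / fact (2 * m + 1)) :: complex)"
      by (simp add: sin_coeff_def)
    have "sin_coeff (2 * m + 1) *\<^sub>R (of_real pi * w) ^ (2 * m + 1) =
      ((-1) ^ m * (-1) ^ m) * (of_real (1 / fact (2 * m + 1)) * of_real pi ^ (2 * m)) * s ^ m * (of_real pi * w)"
      unfolding pow scaleR_conv_of_real coeff by (simp only: mult.assoc mult.left_commute)
    also have "(-1) ^ m * (-1) ^ m = (1 :: complex)"
      by (simp flip: power_mult_distrib)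
    finally show ?thesis by simp
  qed
  ultimately show ?thesis by simp
qed

text \<open>Euler's product \<open>sin (\<pi> w) = \<pi> w \<Prod> (1 - w\<^sup>2 / k\<^sup>2)\<close> at \<open>w = \<surd>(- s)\<close> identifies the
  generating function with the sine series, and the coefficients of a convergent power series are
  determined by its values near \<open>0\<close>.\<close>

theorem zeta22_eq: "zeta22 m = pi ^ (2 * m) / fact (2 * m + 1)"
proof -
  define F where "F = Abs_fps (\<lambda>m. of_real (zeta22 m) :: complex)"
  define G where "G = Abs_fps (\<lambda>m. of_real (pi ^ (2 * m) / fact (2 * m + 1)) :: complex)"
  (* any radius strictly below the bound 6 / pi^2 of the generating function *)
  define r where "r = 3 / pi\<^sup>2"
  have r: "r > 0" "r < 6 / pi\<^sup>2"
    by (simp_all add: r_def divide_strict_right_mono)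
  have sumG: "summable (\<lambda>m. of_real (pi ^ (2 * m) / fact (2 * m + 1)) * s ^ m)" for s :: complex
  proof (cases "s = 0")
    case False
    define w where "w = csqrt (- s)"
    have "w\<^sup>2 = - s" by (simp add: w_def)
    then have "of_real pi * w \<noteq> 0" using False by auto
    then have cancel: "x * (of_real pi * w) * inverse (of_real pi * w) = x" for x :: complex
      by (simp only: mult.assoc[of x] right_inverse[OF \<open>of_real pi * w \<noteq> 0\<close>] mult_1_right)
    show ?thesis
      using summable_mult2[OF sums_summable[OF sin_series_in_square[OF \<open>w\<^sup>2 = - s\<close>]],
          of "inverse (of_real pi * w)"]
      by (simp only: cancel)
  qed (simp only: summable_zero_power')
  have eq: "eval_fps F s = eval_fps G s" if "norm s < r" for s
  proof (cases "s = 0")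
    case True
    have "zeta22 0 = 1"
      unfolding zeta22_def by (subst suminf_finite[of "{0}"]) auto
    then show ?thesis
      using True by (simp add: F_def G_def eval_fps_at_0)
  next
    case False
    define w where "w = csqrt (- s)"
    have w: "w\<^sup>2 = - s" "w \<noteq> 0" using False by (simp_all add: w_def)
    have "(\<lambda>N. of_real pi * w * (\<Prod>k=1..N. 1 + s / of_nat k ^ 2)) \<longlonglongrightarrow>
       of_real pi * w * eval_fps F s"
      unfolding F_def eval_fps_def fps_nth_Abs_fps
      using that r by (intro tendsto_mult tendsto_const zeta22_generating_function) linarith
    moreover have "(\<lambda>N. of_real pi * w * (\<Prod>k=1..N. 1 + s / of_nat k ^ 2)) \<longlonglongrightarrow> sin (of_real pi * w)"
      using sin_product_formula_complex[of w] by (simp add: w)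
    ultimately have "of_real pi * w * eval_fps F s = sin (of_real pi * w)"
      by (rule LIMSEQ_unique)
    also have "\<dots> = eval_fps G s * (of_real pi * w)"
      using sums_unique[OF sin_series_in_square[OF w(1)]] suminf_mult2[OF sumG[of s], of "of_real pi * w"]
      by (simp add: eval_fps_def G_def)
    finally show ?thesis using w by simp
  qed
  have r_pos: "0 < ereal (norm (of_real r :: complex))"
    using r by simp
  have "summable (\<lambda>n. of_real (zeta22 n) * (of_real r :: complex) ^ n)"
    using r by (intro zeta22_generating_function(2)) auto
  then have "fps_conv_radius F \<ge> norm (of_real r :: complex)"
    unfolding fps_conv_radius_def F_def fps_nth_Abs_fps by (rule conv_radius_geI)
  from less_le_trans[OF r_pos this] have "fps_conv_radius F > 0" .
  moreover have "fps_conv_radius G \<ge> norm (of_real r :: complex)"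
    unfolding fps_conv_radius_def G_def fps_nth_Abs_fps by (rule conv_radius_geI[OF sumG])
  from less_le_trans[OF r_pos this] have "fps_conv_radius G > 0" .
  moreover have "eventually (\<lambda>s. s \<in> ball 0 r) (nhds (0 :: complex))"
    using r by (intro eventually_nhds_in_open) auto
  then have "eventually (\<lambda>s. eval_fps F s = eval_fps G s) (nhds 0)"
    by eventually_elim (auto intro: eq)
  ultimately have "F = G" by (rule eval_fps_eqD)
  then have "fps_nth F m = fps_nth G m" by simp
  then show ?thesis
    unfolding F_def G_def fps_nth_Abs_fps of_real_eq_iff .
qed

section \<open>Iterated integrals over the simplex\<close>

definition in_simplex :: "nat \<Rightarrow> real \<Rightarrow> (nat \<Rightarrow> real) \<Rightarrow> bool" where
  "in_simplex n x t \<longleftrightarrow>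
     (\<forall>i<n. 0 \<le> t i \<and> t i \<le> x) \<and> (\<forall>i j. i < j \<and> j < n \<longrightarrow> t i \<le> t j)"

lemma in_simplex_Suc:
  "in_simplex (Suc n) x (t(n := y)) \<longleftrightarrow> y \<in> {0..x} \<and> in_simplex n y t"
  unfolding in_simplex_def by (auto simp: less_Suc_eq)

lemma component_measurable:
  "i < n \<Longrightarrow> (\<lambda>t. t i) \<in> borel_measurable (Pi\<^sub>M {..<n} (\<lambda>_. lborel :: real measure))"
  using measurable_component_singleton[of i "{..<n}" "\<lambda>_. lborel :: real measure"] by simp

lemma pred_in_simplex [measurable]:
  "Measurable.pred (Pi\<^sub>M {..<n} (\<lambda>_. lborel)) (in_simplex n x)"
proof -
  have "in_simplex n x = (\<lambda>t. (\<forall>i\<in>{..<n}. 0 \<le> t i \<and> t i \<le> x) \<and> (\<forall>j\<in>{..<n}. \<forall>i\<in>{..<j}. t i \<le> t j))"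
    by (auto simp: in_simplex_def fun_eq_iff)
  moreover have "Measurable.pred (Pi\<^sub>M {..<n} (\<lambda>_. lborel)) (\<lambda>t. 0 \<le> t i \<and> t i \<le> x)" if "i < n" for i
    using component_measurable[OF that] by measurable
  moreover have "Measurable.pred (Pi\<^sub>M {..<n} (\<lambda>_. lborel)) (\<lambda>t. t i \<le> (t j :: real))"
    if "i < n" "j < n" for i j
    unfolding pred_def by (intro borel_measurable_le component_measurable that)
  ultimately show ?thesis
    by (simp only:) (intro pred_intros_logic pred_intros_finite; auto)
qed

definition simplex_integral :: "(nat \<Rightarrow> real \<Rightarrow> ennreal) \<Rightarrow> nat \<Rightarrow> real \<Rightarrow> ennreal" where
  "simplex_integral f n x =
     (\<integral>\<^sup>+ t. (\<Prod>k<n. f k (t k)) * indicator (Collect (in_simplex n x)) t \<partial>Pi\<^sub>M {..<n} (\<lambda>_. lborel))"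

lemma simplex_integrand_measurable:
  assumes "\<And>k. f k \<in> borel_measurable borel"
  shows "(\<lambda>t. (\<Prod>k<n. f k (t k)) * indicator (Collect (in_simplex n x)) t :: ennreal)
    \<in> borel_measurable (Pi\<^sub>M {..<n} (\<lambda>_. lborel))"
proof -
  have "(\<lambda>t. f k (t k)) \<in> borel_measurable (Pi\<^sub>M {..<n} (\<lambda>_. lborel))" if "k < n" for k
    using measurable_compose[OF component_measurable[OF that] assms] .
  then have "(\<lambda>t. \<Prod>k<n. f k (t k)) \<in> borel_measurable (Pi\<^sub>M {..<n} (\<lambda>_. lborel))"
    by (intro borel_measurable_prod_ennreal) auto
  moreover have "(\<lambda>t. indicator (Collect (in_simplex n x)) t :: ennreal) =
     (\<lambda>t. if in_simplex n x t then 1 else 0)"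
    by (auto simp: indicator_def)
  moreover have "(\<lambda>t. if in_simplex n x t then 1 else 0 :: ennreal)
     \<in> borel_measurable (Pi\<^sub>M {..<n} (\<lambda>_. lborel))"
    by measurable
  ultimately show ?thesis
    by (intro borel_measurable_times_ennreal) simp_all
qed

lemma simplex_integral_0: "simplex_integral f 0 x = 1"
  by (simp add: simplex_integral_def PiM_empty nn_integral_count_space_finite in_simplex_def)

interpretation lborel_product: product_sigma_finite "\<lambda>_ :: nat. lborel :: real measure"
  by unfold_locales

text \<open>Fubini with the largest variable outermost: the remaining ones then run through a simplex of
  lower dimension with that variable as upper bound.\<close>

lemma simplex_integral_Suc:
  assumes "\<And>k. f k \<in> borel_measurable borel"
  shows "simplex_integral f (Suc n) x =
    (\<integral>\<^sup>+ y. f n y * simplex_integral f n y * indicator {0..x} y \<partial>lborel)"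
proof -
  have "simplex_integral f (Suc n) x =
    (\<integral>\<^sup>+ y. \<integral>\<^sup>+ t. (\<Prod>k<Suc n. f k ((t(n := y)) k)) * indicator (Collect (in_simplex (Suc n) x)) (t(n := y))
        \<partial>Pi\<^sub>M {..<n} (\<lambda>_. lborel) \<partial>lborel)"
    unfolding simplex_integral_def lessThan_Suc
    by (rule lborel_product.product_nn_integral_insert_rev)
      (use simplex_integrand_measurable[of f "Suc n" x, OF assms] in \<open>simp_all add: lessThan_Suc\<close>)
  also have "\<dots> = (\<integral>\<^sup>+ y. \<integral>\<^sup>+ t. f n y * indicator {0..x} y *
        ((\<Prod>k<n. f k (t k)) * indicator (Collect (in_simplex n y)) t)
        \<partial>Pi\<^sub>M {..<n} (\<lambda>_. lborel) \<partial>lborel)"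
    by (intro nn_integral_cong) (auto simp: in_simplex_Suc mult_ac split: split_indicator)
  also have "\<dots> = (\<integral>\<^sup>+ y. f n y * indicator {0..x} y * simplex_integral f n y \<partial>lborel)"
    unfolding simplex_integral_def
    by (intro nn_integral_cong nn_integral_cmult simplex_integrand_measurable assms)
  finally show ?thesis by (simp add: mult_ac)
qed

lemma nn_integral_power_series:
  assumes "\<And>j. a j \<ge> 0" "x \<ge> 0"
  shows "(\<integral>\<^sup>+ t. suminf (\<lambda>j. ennreal (a j * t ^ j)) * indicator {0..x} t \<partial>lborel) =
    suminf (\<lambda>j. ennreal (a j / real (Suc j) * x ^ Suc j))"
proof -
  have int: "(\<integral>\<^sup>+ t. ennreal (a j * t ^ j) * indicator {0..x} t \<partial>lborel) =
      ennreal (a j / real (Suc j) * x ^ Suc j)" for j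
    using assms
    by (subst nn_integral_FTC_Icc[where F = "\<lambda>t. a j / real (Suc j) * t ^ Suc j"])
      (auto intro!: derivative_eq_intros simp del: of_nat_Suc power_Suc)
  have "(\<integral>\<^sup>+ t. suminf (\<lambda>j. ennreal (a j * t ^ j)) * indicator {0..x} t \<partial>lborel) =
      (\<integral>\<^sup>+ t. suminf (\<lambda>j. ennreal (a j * t ^ j) * indicator {0..x} t) \<partial>lborel)"
    by (simp only: ennreal_suminf_multc)
  also have "\<dots> = suminf (\<lambda>j. \<integral>\<^sup>+ t. ennreal (a j * t ^ j) * indicator {0..x} t \<partial>lborel)"
    by (intro nn_integral_suminf) measurable
  finally show ?thesis
    by (simp only: int)
qed

text \<open>The absolute values on the unit interval of the forms \<open>dt/(t - 1)\<close> and \<open>dt/t\<close> in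
  alternation. Passing to them makes all integrands nonnegative, so that the integrals can be
  computed in the extended reals without integrability conditions.\<close>

definition zeta22_form :: "nat \<Rightarrow> real \<Rightarrow> real" where
  "zeta22_form k t = (if even k then 1 / (1 - t) else 1 / t)"

lemma zeta22_form_measurable [measurable]: "zeta22_form k \<in> borel_measurable borel"
  unfolding zeta22_form_def[abs_def] by (cases "even k") simp_all

text \<open>A Cauchy product with the geometric series.\<close>

lemma zeta22_series_divide:
  assumes t: "0 \<le> t" "t < 1"
  shows "ennreal (1 / (1 - t)) * suminf (\<lambda>k. ennreal (zeta22_coeff m k * t ^ k)) =
    suminf (\<lambda>j. ennreal ((\<Sum>i\<le>j. zeta22_coeff m i) * t ^ j))"
proof -
  have le: "norm (zeta22_coeff m k * t ^ k) \<le> zeta22_coeff m k" for k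
  proof -
    have "zeta22_coeff m k * t ^ k \<le> zeta22_coeff m k * 1"
      using t by (intro mult_left_mono power_le_one) simp_all
    then show ?thesis
      using t by simp
  qed
  have sc: "summable (\<lambda>k. zeta22_coeff m k * t ^ k)"
    by (rule summable_comparison_test'[OF conjunct1[OF zeta22_coeff_bound[of m]]]) (rule le)
  have nonneg: "suminf (\<lambda>k. zeta22_coeff m k * t ^ k) \<ge> 0"
    using t by (intro suminf_nonneg sc) auto
  have "(\<lambda>j. \<Sum>i\<le>j. (zeta22_coeff m i * t ^ i) * t ^ (j - i)) sums
      (suminf (\<lambda>k. zeta22_coeff m k * t ^ k) * suminf (\<lambda>k. t ^ k))"
  proof (rule Cauchy_product_sums)
    have "norm (zeta22_coeff m k * t ^ k) = zeta22_coeff m k * t ^ k" for k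
      using t by simp
    with sc show "summable (\<lambda>k. norm (zeta22_coeff m k * t ^ k))"
      by (simp only:)
    have "norm (norm t) < 1"
      using t by simp
    from summable_geometric[OF this] show "summable (\<lambda>k. norm (t ^ k))"
      by (simp only: norm_power)
  qed
  moreover have "(\<Sum>i\<le>j. (zeta22_coeff m i * t ^ i) * t ^ (j - i)) =
      (\<Sum>i\<le>j. zeta22_coeff m i) * t ^ j" for j
    unfolding sum_distrib_right
    by (rule sum.cong) (auto simp: mult.assoc simp flip: power_add)
  moreover have "suminf (\<lambda>k. t ^ k) = 1 / (1 - t)"
    using t by (intro suminf_geometric) simp
  ultimately have sums: "(\<lambda>j. (\<Sum>i\<le>j. zeta22_coeff m i) * t ^ j) sums
      (suminf (\<lambda>k. zeta22_coeff m k * t ^ k) * (1 / (1 - t)))"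
    by (simp only:)
  have "(\<Sum>i\<le>j. zeta22_coeff m i) * t ^ j \<ge> 0" for j
    using t by (intro mult_nonneg_nonneg sum_nonneg) auto
  from suminf_ennreal_eq[OF this sums] have "suminf (\<lambda>j. ennreal ((\<Sum>i\<le>j. zeta22_coeff m i) * t ^ j)) =
      ennreal (suminf (\<lambda>k. zeta22_coeff m k * t ^ k) * (1 / (1 - t)))" .
  also have "\<dots> = ennreal (suminf (\<lambda>k. zeta22_coeff m k * t ^ k)) * ennreal (1 / (1 - t))"
    by (rule ennreal_mult[OF nonneg]) (use t in simp)
  also have "ennreal (suminf (\<lambda>k. zeta22_coeff m k * t ^ k)) =
      suminf (\<lambda>k. ennreal (zeta22_coeff m k * t ^ k))"
    by (rule suminf_ennreal2[symmetric, OF _ sc]) (use t in simp)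
  finally show ?thesis by (simp only: mult.commute)
qed

lemma simplex_integral_zeta22_step:
  assumes "x \<in> {0..1}"
    and IH: "\<And>y. y \<in> {0..1} \<Longrightarrow> simplex_integral (\<lambda>k t. ennreal (zeta22_form k t)) (2 * m) y =
       suminf (\<lambda>k. ennreal (zeta22_coeff m k * y ^ k))"
  shows "simplex_integral (\<lambda>k t. ennreal (zeta22_form k t)) (Suc (2 * m)) x =
    suminf (\<lambda>j. ennreal ((\<Sum>i\<le>j. zeta22_coeff m i) / real (Suc j) * x ^ Suc j))"
proof -
  have "simplex_integral (\<lambda>k t. ennreal (zeta22_form k t)) (Suc (2 * m)) x =
      (\<integral>\<^sup>+ t. suminf (\<lambda>j. ennreal ((\<Sum>i\<le>j. zeta22_coeff m i) * t ^ j)) * indicator {0..x} t \<partial>lborel)"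
  proof (subst simplex_integral_Suc, simp, rule nn_integral_cong_AE)
    show "AE t in lborel. ennreal (zeta22_form (2 * m) t) *
        simplex_integral (\<lambda>k t. ennreal (zeta22_form k t)) (2 * m) t * indicator {0..x} t =
        suminf (\<lambda>j. ennreal ((\<Sum>i\<le>j. zeta22_coeff m i) * t ^ j)) * indicator {0..x} t"
      (* at t = 1 the form takes the default value 1 / 0 = 0, and the identity fails there *)
      using AE_lborel_singleton[of 1]
    proof eventually_elim
      case (elim t)
      show ?case
      proof (cases "t \<in> {0..x}")
        case True
        then have t: "0 \<le> t" "t < 1" "t \<in> {0..1}" using elim assms(1) by auto
        have form: "zeta22_form (2 * m) t = 1 / (1 - t)"
          by (simp add: zeta22_form_def)
        show ?thesis
          by (simp only: form IH[OF t(3)] zeta22_series_divide[OF t(1,2)])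
      qed simp
    qed
  qed
  also have "\<dots> = suminf (\<lambda>j. ennreal ((\<Sum>i\<le>j. zeta22_coeff m i) / real (Suc j) * x ^ Suc j))"
    using assms(1) by (intro nn_integral_power_series sum_nonneg) auto
  finally show ?thesis .
qed

text \<open>Integrating against \<open>dt/(1 - t)\<close> replaces the coefficients of a power series by their
  partial sums divided by the new exponent, and integrating against \<open>dt/t\<close> divides by the exponent
  once more: together this is the recursion of \<open>zeta22_coeff\<close>.\<close>

lemma simplex_integral_zeta22:
  assumes "x \<in> {0..1}"
  shows "simplex_integral (\<lambda>k t. ennreal (zeta22_form k t)) (2 * m) x =
       suminf (\<lambda>k. ennreal (zeta22_coeff m k * x ^ k))"
  using assms
proof (induction m arbitrary: x)
  case 0
  show ?case
    by (subst suminf_finite[of "{0}"]) (auto simp: simplex_integral_0)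
next
  case (Suc m)
  let ?a = "\<lambda>j. (\<Sum>i\<le>j. zeta22_coeff m i) / real (Suc j)"
  have a: "?a j \<ge> 0" for j
    by (intro divide_nonneg_nonneg sum_nonneg) auto
  have "simplex_integral (\<lambda>k t. ennreal (zeta22_form k t)) (2 * Suc m) x =
      (\<integral>\<^sup>+ t. suminf (\<lambda>j. ennreal (?a j * t ^ j)) * indicator {0..x} t \<partial>lborel)"
  proof (simp only: mult_Suc_right add_2_eq_Suc, subst simplex_integral_Suc, simp, rule nn_integral_cong_AE)
    show "AE t in lborel. ennreal (zeta22_form (Suc (2 * m)) t) *
        simplex_integral (\<lambda>k t. ennreal (zeta22_form k t)) (Suc (2 * m)) t * indicator {0..x} t =
        suminf (\<lambda>j. ennreal (?a j * t ^ j)) * indicator {0..x} t"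
      (* 1 / t takes the default value 0 at t = 0 *)
      using AE_lborel_singleton[of 0]
    proof eventually_elim
      case (elim t)
      show ?case
      proof (cases "t \<in> {0..x}")
        case True
        then have t: "t \<in> {0..1}" "t > 0" using elim Suc.prems by auto
        have "ennreal (1 / t) * ennreal (?a j * t ^ Suc j) = ennreal (?a j * t ^ j)" for j
        proof -
          have "ennreal (1 / t) * ennreal (?a j * t ^ Suc j) = ennreal (1 / t * (?a j * t ^ Suc j))"
            using t a[of j] by (intro ennreal_mult[symmetric] mult_nonneg_nonneg) auto
          also have "1 / t * (?a j * t ^ Suc j) = ?a j * t ^ j"
            using t by simp
          finally show ?thesis .
        qed
        moreover have "zeta22_form (Suc (2 * m)) t = 1 / t"
          by (simp add: zeta22_form_def)
        ultimately show ?thesis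
          by (simp only: simplex_integral_zeta22_step[OF t(1) Suc.IH] ennreal_suminf_cmult[symmetric])
      qed simp
    qed
  qed
  also have "\<dots> = suminf (\<lambda>j. ennreal (?a j / real (Suc j) * x ^ Suc j))"
    using Suc.prems a by (intro nn_integral_power_series) auto
  also have "\<dots> = suminf (\<lambda>j. ennreal (zeta22_coeff (Suc m) (Suc j) * x ^ Suc j))"
    by (simp add: power2_eq_square del: of_nat_Suc power_Suc)
  also have "\<dots> = suminf (\<lambda>k. ennreal (zeta22_coeff (Suc m) k * x ^ k))"
    using sums_unique[OF sums_Suc[of "\<lambda>k. ennreal (zeta22_coeff (Suc m) k * x ^ k)"], OF summable_sums[OF summableI]]
    by simp
  finally show ?case .
qed

text \<open>The inner letters \<open>1, 0, \<dots>, 1, 0\<close> of the alternating word of length \<open>2m + 2\<close>.\<close>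

definition zeta22_letters :: "nat \<Rightarrow> nat list" where
  "zeta22_letters m = map (\<lambda>k. if even k then 1 else 0) [0..<2 * m]"

text \<open>Each of the \<open>m\<close> forms \<open>dt/(t - 1)\<close> contributes a sign.\<close>

lemma iterated_integral_zeta22:
  "iterated_integral (zeta22_letters m) = (-1) ^ m * zeta22 m"
proof -
  let ?M = "Pi\<^sub>M {..<2 * m} (\<lambda>_. lborel) :: (nat \<Rightarrow> real) measure"
  let ?g = "\<lambda>t. (\<Prod>k<2 * m. zeta22_form k (t k)) * indicator (Collect (in_simplex (2 * m) 1)) t :: real"
  have sign: "(\<Prod>k<2 * m. if even k then -1 else 1) = ((-1) ^ m :: real)"
    by (induction m) auto
  have "iterated_integral (zeta22_letters m) = (\<integral>t. (-1) ^ m * ?g t \<partial>?M)"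
    unfolding iterated_integral_def set_lebesgue_integral_def
  proof (rule Bochner_Integration.integral_cong)
    fix t assume t: "t \<in> space (Pi\<^sub>M {..<2 * m} (\<lambda>_. lborel) :: (nat \<Rightarrow> real) measure)"
    have "(\<Prod>k<2 * m. 1 / (t k - real (zeta22_letters m ! k))) =
        (\<Prod>k<2 * m. (if even k then -1 else 1) * zeta22_form k (t k))"
      by (rule prod.cong) (auto simp: zeta22_letters_def zeta22_form_def minus_divide_right)
    then have "(\<Prod>k<2 * m. 1 / (t k - real (zeta22_letters m ! k))) =
        (-1) ^ m * (\<Prod>k<2 * m. zeta22_form k (t k))"
      by (simp only: prod.distrib sign)
    moreover have "t \<in> simplex_domain (2 * m) \<longleftrightarrow> in_simplex (2 * m) 1 t"
      using t unfolding simplex_domain_def in_simplex_def by blast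
    ultimately show "indicat_real (simplex_domain (length (zeta22_letters m))) t *\<^sub>R
        (\<Prod>k<length (zeta22_letters m). 1 / (t k - real (zeta22_letters m ! k))) = (-1) ^ m * ?g t"
      by (simp add: zeta22_letters_def indicator_def)
  qed (simp add: zeta22_letters_def)
  also have "\<dots> = (-1) ^ m * (\<integral>t. ?g t \<partial>?M)"
    by simp
  also have "(\<integral>t. ?g t \<partial>?M) = enn2real (\<integral>\<^sup>+ t. ennreal (?g t) \<partial>?M)"
  proof (rule integral_eq_nn_integral)
    have "(\<lambda>t. zeta22_form k (t k)) \<in> borel_measurable ?M" if "k < 2 * m" for k
      using measurable_compose[OF component_measurable[OF that] zeta22_form_measurable] .
    then have "(\<lambda>t. \<Prod>k<2 * m. zeta22_form k (t k)) \<in> borel_measurable ?M"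
      by (intro borel_measurable_prod) auto
    moreover have "(\<lambda>t. if in_simplex (2 * m) 1 t then 1 else 0 :: real) \<in> borel_measurable ?M"
      by measurable
    ultimately show "?g \<in> borel_measurable ?M"
      unfolding indicator_def mem_Collect_eq of_bool_def by (intro borel_measurable_times)
  qed (auto intro!: AE_I2 prod_nonneg simp: zeta22_form_def in_simplex_def split: split_indicator)
  also have "(\<integral>\<^sup>+ t. ennreal (?g t) \<partial>?M) = simplex_integral (\<lambda>k t. ennreal (zeta22_form k t)) (2 * m) 1"
    unfolding simplex_integral_def
  proof (intro nn_integral_cong)
    fix t :: "nat \<Rightarrow> real"
    have "ennreal (\<Prod>k<2 * m. zeta22_form k (t k)) = (\<Prod>k<2 * m. ennreal (zeta22_form k (t k)))"
      if "in_simplex (2 * m) 1 t"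
      using that by (intro prod_ennreal[symmetric]) (auto simp: zeta22_form_def in_simplex_def)
    then show "ennreal (?g t) =
        (\<Prod>k<2 * m. ennreal (zeta22_form k (t k))) * indicator (Collect (in_simplex (2 * m) 1)) t"
      by (auto split: split_indicator)
  qed
  also have "\<dots> = ennreal (zeta22 m)"
    using simplex_integral_zeta22[of 1 m] zeta22_coeff_bound[of m]
    by (simp add: zeta22_def suminf_ennreal2)
  finally show ?thesis
    by (simp add: zeta22_nonneg)
qed

section \<open>The values on letters\<close>

lemma corresponds_letter:
  assumes "e_word w" "w \<noteq> []" "hd w = 0" "distinct_adj w" "length w = index a"
  shows "corresponds w [a]"
proof -
  have "length [w] \<le> length vs" if "alternating_factorisation w vs" for vs
    using that assms(2) by (cases vs) (auto simp: alternating_factorisation_def)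
  then have "minimal_factorisation w [w]"
    using assms by (simp add: minimal_factorisation_def alternating_factorisation_def alternating_def)
  then show ?thesis
    using assms unfolding corresponds_def by (intro conjI exI[of _ "[w]"]) auto
qed

lemma corresponds_alternating_word:
  "corresponds (map (\<lambda>k. k mod 2) [0..<index a]) [a]"
proof (rule corresponds_letter)
  have pos: "0 < index a"
    using index[of a] by simp
  show "e_word (map (\<lambda>k. k mod 2) [0..<index a])"
    by (auto simp: e_word_def)
  show "map (\<lambda>k. k mod 2) [0..<index a] \<noteq> []" "hd (map (\<lambda>k. k mod 2) [0..<index a]) = 0"
    using pos by (simp_all add: hd_map)
  have "i mod 2 \<noteq> Suc i mod 2" for i :: nat
    by presburger
  then show "distinct_adj (map (\<lambda>k. k mod 2) [0..<index a])"
    by (simp add: distinct_adj_conv_nth)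
qed simp

lemma alternating_word_even:
  "map (\<lambda>k. k mod 2) [0..<2 * m + 2] = 0 # zeta22_letters m @ [1]"
proof -
  have "[0..<2 * m + 2] = 0 # map Suc [0..<2 * m] @ [2 * m + 1]"
    by (simp add: map_Suc_upt upt_conv_Cons)
  then show ?thesis
    by (auto simp: zeta22_letters_def mod_Suc even_iff_mod_2_eq_zero)
qed

lemma zeta22_letters_convergent:
  "zeta22_letters m = [] \<or> hd (zeta22_letters m) = 1 \<and> last (zeta22_letters m) = 0"
proof (cases m)
  case (Suc j)
  then have "zeta22_letters m \<noteq> []"
    by (simp add: zeta22_letters_def)
  moreover have "zeta22_letters m ! 0 = 1" "zeta22_letters m ! (2 * m - 1) = 0"
    using Suc by (simp_all add: zeta22_letters_def nth_append)
  moreover have "length (zeta22_letters m) = 2 * m"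
    by (simp add: zeta22_letters_def)
  ultimately show ?thesis
    by (simp add: hd_conv_nth last_conv_nth)
qed (simp add: zeta22_letters_def)

text \<open>An alternating word of odd length ends in \<open>e\<^sub>0\<close>, where \<open>I\<close> vanishes; one of length
  \<open>2m + 2\<close> encodes \<open>\<plusminus>\<zeta>(2, \<dots>, 2)\<close> with \<open>m\<close> entries.\<close>

lemma block_integral_letter:
  assumes "block_integral_map I"
  shows "I (word [a]) =
    (if even (index a) then (- 1) ^ (index a div 2 - 1) * zeta22 (index a div 2 - 1) else 0)"
proof (cases "even (index a)")
  case True
  define m where "m = index a div 2 - 1"
  have "index a \<noteq> 0"
    using index[of a] by simp
  with True have m: "index a = 2 * m + 2"
    unfolding m_def by presburger
  have "corresponds (0 # zeta22_letters m @ [1]) [a]"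
    using corresponds_alternating_word[of a] unfolding m alternating_word_even .
  then have "I (word [a]) = iterated_integral (zeta22_letters m)"
    using assms zeta22_letters_convergent[of m] unfolding block_integral_map_def by blast
  then show ?thesis
    using m by (simp add: iterated_integral_zeta22)
next
  case False
  then have "last (map (\<lambda>k. k mod 2) [0..<index a]) = 0"
    using index[of a] by (subst last_map) (auto elim!: oddE)
  then have "I (word [a]) = 0"
    using assms corresponds_alternating_word[of a] unfolding block_integral_map_def by blast
  then show ?thesis
    using False by simp
qed

lemma Q_pi_squared_monomial: "of_rat c * (pi\<^sup>2) ^ n \<in> Q_pi_squared"
  unfolding Q_pi_squared_def
  by (rule range_eqI[of _ _ "Polynomial.monom c n"]) (simp add: map_poly_monom poly_monom)

lemma Q_pi_squared_combination:
  assumes "x \<in> Q_pi_squared" "y \<in> Q_pi_squared"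
  shows "of_rat c * x + y \<in> Q_pi_squared"
proof -
  obtain p q where pq: "x = poly (map_poly of_rat p) (pi\<^sup>2)" "y = poly (map_poly of_rat q) (pi\<^sup>2)"
    using assms by (auto simp: Q_pi_squared_def)
  have "map_poly of_rat (smult c p + q) = smult (of_rat c) (map_poly of_rat p) + (map_poly of_rat q :: real poly)"
    by (rule poly_eqI) (simp add: coeff_map_poly of_rat_add of_rat_mult)
  then have "of_rat c * x + y = poly (map_poly of_rat (smult c p + q)) (pi\<^sup>2)"
    by (simp add: pq)
  then show ?thesis
    by (auto simp: Q_pi_squared_def)
qed

lemma block_integral_letter_span:
  assumes I: "block_integral_map I" and "p \<in> letter_span"
  shows "I p \<in> Q_pi_squared"
proof -
  have zero: "0 \<in> Q_pi_squared"
    using Q_pi_squared_monomial[of 0 0] by simp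
  have letter: "I (word [a]) \<in> Q_pi_squared" for a
  proof -
    define m where "m = index a div 2 - 1"
    have "of_rat (fact (2 * m + 1)) = (fact (2 * m + 1) :: real)"
      by (metis of_nat_fact of_rat_of_nat_eq)
    then have "(- 1) ^ m * zeta22 m = of_rat ((- 1) ^ m / fact (2 * m + 1)) * (pi\<^sup>2) ^ m"
      by (simp add: zeta22_eq of_rat_divide of_rat_power of_rat_minus power_mult del: fact_Suc)
    then show ?thesis
      unfolding block_integral_letter[OF I] m_def[symmetric]
      using Q_pi_squared_monomial[of "(- 1) ^ m / fact (2 * m + 1)" m] zero by simp
  qed
  show ?thesis
    using assms(2)
    by (induction p rule: letter_span_induct)
      (simp_all add: block_integral_mapD[OF I] zero letter Q_pi_squared_combination)
qed

theorem corollary4p8: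
  fixes I :: "(posnat list \<Rightarrow>\<^sub>0 rat) \<Rightarrow> real"
    and z :: "posnat list \<Rightarrow>\<^sub>0 rat"
    and k :: nat
  assumes "block_integral_map I"
    and "z \<in> letter_span"
    and "k \<ge> 1"
  shows "I (z ^ (2 * k + 1)) = 1 / real (2 * k + 1) * I (lozenge_power z (2 * k + 1))
    \<and> I (z ^ (2 * k + 1)) \<in> I ` letter_span
    \<and> I ` letter_span \<subseteq> Q_pi_squared
    \<and> I (z ^ (2 * k)) = 0"
proof (intro conjI)
  let ?n = "2 * k + 1"
  have "x = 1 / c * y" if "c \<noteq> 0" "c * x = y" for c x y :: real
    using that by auto
  from this[OF _ block_integral_power(1)[OF assms(1,2), of k]]
  show odd: "I (z ^ ?n) = 1 / real ?n * I (lozenge_power z ?n)"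
    by simp
  have "of_rat (1 / of_nat ?n) = 1 / real ?n"
    by (simp only: of_rat_divide of_rat_1 of_rat_of_nat_eq)
  then have "I (z ^ ?n) = I (scale (1 / of_nat ?n) (lozenge_power z ?n))"
    by (simp only: odd block_integral_mapD(4)[OF assms(1)])
  then show "I (z ^ ?n) \<in> I ` letter_span"
    using lozenge_power_in_letter_span[OF assms(2)] letter_span_closed(3) by blast
  show "I ` letter_span \<subseteq> Q_pi_squared"
    using block_integral_letter_span[OF assms(1)] by blast
  obtain m where "k = Suc m"
    using assms(3) by (cases k) auto
  then show "I (z ^ (2 * k)) = 0"
    using block_integral_power(2)[OF assms(1,2), of m] by simp
qed

end
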